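(* Let $n\in\mathbb{N}$, $k\in\{0,1,\ldots,n-1\}$, $a\in(0,1)$, $1\le p\le\infty$ and $1/p+1/p'=1$. Let $\hat Q^{(n)}_{n,k}(\cdot,a)$ be a function of least $L_{p'}[0,1]$-norm among all functions $Q^{(n)}_{n,k}(\cdot,a)$ (defined in the context, with real parameters $\nu_0,\ldots,\nu_{n-1}$), and let $g_{n,k}(\cdot,a)$ be the function defined in the context. Then $\hat Q^{(n)}_{n,k}$ and $g^{(n)}_{n,k}$ differ by a polynomial of degree at most $n-1$ in $x$; that is, there exist real numbers $c_0(a),\ldots,c_{n-1}(a)$ such that $$ \hat Q^{(n)}_{n,k}(x,a)-g^{(n)}_{n,k}(x,a)=\sum_{l=0}^{n-1}c_l(a)x^l ,\qquad x\in[0,1],\ x\neq a . $$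
   Context: For $\nu_0,\ldots,\nu_{n-1}\in\mathbb{R}$ (possibly depending on $a$), set $$ Q^{(n)}_{n,k}(x,a)= \begin{cases} \displaystyle\sum_{l=0,\,l\ne k}^{n-1}\frac{(-1)^{n-l-1}(x-a)^{n-1-l}\nu_l}{(n-1-l)!}+\frac{(-1)^{n-1-k}(x-a)^{n-1-k}(\nu_k+1)}{(n-1-k)!}, & x\in[0,a),\\[2mm] \displaystyle\sum_{l=0}^{n-1}\frac{(-1)^{n-l-1}(x-a)^{n-1-l}\nu_l}{(n-1-l)!}, & x\in(a,1], \end{cases} $$ with the convention $(x-a)^0=1$. $\mathring{W}^n_2[0,1]$ is the Sobolev space of real-valued functions $y$ on $[0,1]$ whose derivatives up to order $n-1$ are absolutely continuous, with $y^{(n)}\in L_2[0,1]$ and $y^{(j)}(0)=y^{(j)}(1)=0$ for $j=0,\ldots,n-1$, with norm $\|y\|=\|y^{(n)}\|_{L_2[0,1]}$. The function $g_{n,k}(\cdot,a)\in\mathring{W}^n_2[0,1]$ is the unique (Riesz) representer of the functional $f\mapsto f^{(k)}(a)$, i.e. $f^{(k)}(a)=\int_0^1 f^{(n)}(x)g^{(n)}_{n,k}(x,a)\,dx$ for all $f\in\mathring{W}^n_2[0,1]$; here $g^{(n)}_{n,k}$ is the $n$-th derivative in $x$. It is known explicitly: $$ g_{n,k}(x,a)= \begin{cases} \dfrac{(-1)^{n-k-1}}{(2n-k-1)!}(1-a)^{n-k}x^n h_{n,k}(1-x,1-a), & x\in[0,a],\\[2mm] \dfrac{(-1)^{n-1}}{(2n-k-1)!}a^{n-k}(1-x)^n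 h_{n,k}(x,a), & x\in[a,1], \end{cases} $$ where $$ h_{n,k}(x,a)=\sum_{l=0}^{n-1}(-1)^{n-1-l}\binom{2n-1-k}{n-1-l}x^{n-1-l}a^l\sum_{m=0}^{l}\binom{n-1+m}{m}x^m . $$ *)

theory Defs
  imports "HOL-Analysis.Analysis" "HOL-Probability.Essential_Supremum"
begin

section \<open>Sobolev space on the unit interval\<close>

text \<open>Iterated derivatives are taken within \<open>[0,1]\<close> (one-sided at the end points), so they only
  depend on the restriction of \<open>y\<close> to \<open>[0,1]\<close>. At a point of non-differentiability the value is
  unspecified.\<close>

definition nth_deriv :: "nat \<Rightarrow> (real \<Rightarrow> real) \<Rightarrow> real \<Rightarrow> real" where
  "nth_deriv j = ((\<lambda>y x. vector_derivative y (at x within {0..1})) ^^ j)"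

text \<open>A division consists of finitely many compact intervals with pairwise disjoint interiors.\<close>

definition absolutely_continuous_fun_on :: "real set \<Rightarrow> (real \<Rightarrow> real) \<Rightarrow> bool" where
  "absolutely_continuous_fun_on S f \<longleftrightarrow>
     (\<forall>\<epsilon>>0. \<exists>\<delta>>0. \<forall>\<D> T. \<D> division_of T \<and> T \<subseteq> S \<and> (\<Sum>K\<in>\<D>. Sup K - Inf K) < \<delta>
        \<longrightarrow> (\<Sum>K\<in>\<D>. \<bar>f (Sup K) - f (Inf K)\<bar>) < \<epsilon>)"

text \<open>For \<open>n \<ge> 1\<close>. Differentiability of \<open>y\<^sup>(\<^sup>n\<^sup>-\<^sup>1\<^sup>)\<close> almost everywhere is implied by its
  absolute continuity (Lebesgue); it is listed because \<open>y\<^sup>(\<^sup>n\<^sup>)\<close> is only defined at such points.\<close>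

definition sobolev0 :: "nat \<Rightarrow> (real \<Rightarrow> real) set" where
  "sobolev0 n = {y.
     (\<forall>j<n - 1. \<forall>x\<in>{0..1}. nth_deriv j y differentiable (at x within {0..1})) \<and>
     (\<forall>j<n. absolutely_continuous_fun_on {0..1} (nth_deriv j y)) \<and>
     (AE x in lebesgue_on {0..1}. nth_deriv (n - 1) y differentiable (at x within {0..1})) \<and>
     nth_deriv n y \<in> borel_measurable (lebesgue_on {0..1}) \<and>
     integrable (lebesgue_on {0..1}) (\<lambda>x. (nth_deriv n y x)\<^sup>2) \<and>
     (\<forall>j<n. nth_deriv j y 0 = 0 \<and> nth_deriv j y 1 = 0)}"

text \<open>\<open>g\<close> represents the functional \<open>f \<mapsto> f\<^sup>(\<^sup>k\<^sup>)(a)\<close> in the inner product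
  \<open>\<langle>f, g\<rangle> = \<integral> f\<^sup>(\<^sup>n\<^sup>) g\<^sup>(\<^sup>n\<^sup>)\<close>; this determines \<open>g\<close> uniquely on \<open>[0,1]\<close>.\<close>

definition riesz_representer :: "nat \<Rightarrow> nat \<Rightarrow> real \<Rightarrow> (real \<Rightarrow> real) \<Rightarrow> bool" where
  "riesz_representer n k a g \<longleftrightarrow> g \<in> sobolev0 n \<and>
     (\<forall>f\<in>sobolev0 n.
        nth_deriv k f a = (\<integral>x. nth_deriv n f x * nth_deriv n g x \<partial>lebesgue_on {0..1}))"

section \<open>The functions \<open>Q\<close> and their norms\<close>

text \<open>The value at \<open>x = a\<close> (and outside \<open>[0,1]\<close>) is left arbitrary.\<close>

definition is_Q :: "nat \<Rightarrow> nat \<Rightarrow> real \<Rightarrow> (nat \<Rightarrow> real) \<Rightarrow> (real \<Rightarrow> real) \<Rightarrow> bool" where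
  "is_Q n k a \<nu> q \<longleftrightarrow>
     (\<forall>x\<in>{0..<a}. q x =
        (\<Sum>l\<in>{0..n - 1} - {k}. (-1) ^ (n - l - 1) * (x - a) ^ (n - 1 - l) * \<nu> l / fact (n - 1 - l))
        + (-1) ^ (n - 1 - k) * (x - a) ^ (n - 1 - k) * (\<nu> k + 1) / fact (n - 1 - k)) \<and>
     (\<forall>x\<in>{a<..1}. q x =
        (\<Sum>l=0..n - 1. (-1) ^ (n - l - 1) * (x - a) ^ (n - 1 - l) * \<nu> l / fact (n - 1 - l)))"

definition Q_family :: "nat \<Rightarrow> nat \<Rightarrow> real \<Rightarrow> (real \<Rightarrow> real) set" where
  "Q_family n k a = {q. \<exists>\<nu>. is_Q n k a \<nu> q}"

text \<open>The norm of \<open>L\<^sub>p[0,1]\<close> for \<open>1 \<le> p \<le> \<infinity>\<close>, with value \<open>\<infinity>\<close> outside that space.\<close>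

definition Lp_norm :: "ennreal \<Rightarrow> (real \<Rightarrow> real) \<Rightarrow> ennreal" where
  "Lp_norm p f =
     (if p = \<infinity> then esssup (lebesgue_on {0..1}) (\<lambda>x. ennreal \<bar>f x\<bar>)
      else (let r = enn2real p;
                I = (\<integral>\<^sup>+x. ennreal (\<bar>f x\<bar> powr r) \<partial>lebesgue_on {0..1})
            in if I = \<infinity> then \<infinity> else ennreal (enn2real I powr (1 / r))))"

end

theory Submission
  imports Defs
begin

text \<open>Every member of the family \<open>Q\<close> is, off \<open>a\<close>, a polynomial of degree less than \<open>n\<close> plus the
  truncated power \<open>\<tau>(x) = (a - x)\<^sup>n\<^sup>-\<^sup>1\<^sup>-\<^sup>k / (n-1-k)!\<close> for \<open>x < a\<close>, continued by \<open>0\<close> beyond \<open>a\<close>.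
  Hence it is enough to show that \<open>g\<^sup>(\<^sup>n\<^sup>)\<close> has this form too; the polynomial part may be anything.

  The reason is Taylor's formula at \<open>a\<close>: a function \<open>f\<close> in the Sobolev space vanishes to order \<open>n\<close>
  at \<open>0\<close>, so \<open>f\<^sup>(\<^sup>k\<^sup>)(a) = \<integral> f\<^sup>(\<^sup>n\<^sup>) \<tau>\<close>. Since \<open>f\<close> vanishes to order \<open>n\<close> at both end points,
  \<open>f\<^sup>(\<^sup>n\<^sup>)\<close> is orthogonal to every polynomial of degree less than \<open>n\<close>. So every \<open>h\<close> in the space with
  \<open>h\<^sup>(\<^sup>n\<^sup>) = q + \<tau>\<close> and \<open>degree q < n\<close> is a representer (\<open>representer_of_spline\<close>). One such \<open>h\<close> is
  an \<open>n\<close>-fold antiderivative of \<open>\<tau>\<close> plus a polynomial of degree less than \<open>2n\<close> that corrects the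
  boundary values; this is two-point Hermite interpolation, obtained from a Bezout identity
  between \<open>x\<^sup>n\<close> and \<open>(x-1)\<^sup>n\<close> (\<open>hermite_two_point\<close>, \<open>spline_representer_exists\<close>).

  Two representers \<open>g\<close> and \<open>h\<close>, tested against \<open>g\<close> and against \<open>h\<close>, satisfy
  \<open>\<integral> (g\<^sup>(\<^sup>n\<^sup>) - h\<^sup>(\<^sup>n\<^sup>))\<^sup>2 = 0\<close>. This gives \<open>g\<^sup>(\<^sup>n\<^sup>) = h\<^sup>(\<^sup>n\<^sup>)\<close> only almost everywhere. The fundamental theorem of
  calculus for absolutely continuous functions
  (\<open>fundamental_theorem_of_calculus_absolutely_continuous\<close>) turns it into
  \<open>g\<^sup>(\<^sup>n\<^sup>-\<^sup>1\<^sup>) = h\<^sup>(\<^sup>n\<^sup>-\<^sup>1\<^sup>)\<close> at every point of \<open>[0,1]\<close> (\<open>riesz_representer_unique\<close>), so that the derivative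
  of \<open>g\<^sup>(\<^sup>n\<^sup>-\<^sup>1\<^sup>)\<close> exists wherever that of \<open>h\<^sup>(\<^sup>n\<^sup>-\<^sup>1\<^sup>)\<close> does, in particular at every point other than \<open>a\<close>.\<close>

section \<open>Absolutely continuous functions\<close>

lemma division_of_real_interval:
  fixes K :: "real set"
  assumes "\<D> division_of T" "K \<in> \<D>"
  obtains u v where "u \<le> v" "K = {u..v}" "Inf K = u" "Sup K = v" "u \<in> T" "v \<in> T"
proof -
  obtain u v where K: "K = cbox u v" "K \<noteq> {}" "K \<subseteq> T"
    using division_ofD(2-4)[OF assms(1)] assms(2) by metis
  then show thesis
    using that[of u v] by (auto simp: subset_eq)
qed

lemma absolutely_continuous_fun_on_subset:
  assumes "absolutely_continuous_fun_on S f" "T \<subseteq> S"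
  shows "absolutely_continuous_fun_on T f"
  using assms unfolding absolutely_continuous_fun_on_def by (meson order_trans)

lemma absolutely_continuous_fun_onD:
  assumes "absolutely_continuous_fun_on S f" "\<epsilon> > 0"
  obtains \<delta> where "\<delta> > 0"
    "\<And>\<D> T. \<D> division_of T \<Longrightarrow> T \<subseteq> S \<Longrightarrow> (\<Sum>K\<in>\<D>. Sup K - Inf K) < \<delta>
        \<Longrightarrow> (\<Sum>K\<in>\<D>. \<bar>f (Sup K) - f (Inf K)\<bar>) < \<epsilon>"
  using assms unfolding absolutely_continuous_fun_on_def by metis

lemma lipschitz_imp_absolutely_continuous_fun_on:
  assumes L: "L-lipschitz_on S f"
  shows "absolutely_continuous_fun_on S f"
  unfolding absolutely_continuous_fun_on_def
proof (intro allI impI)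
  fix e :: real assume e: "e > 0"
  have L0: "L \<ge> 0" using L by (rule lipschitz_on_nonneg)
  show "\<exists>\<delta>>0. \<forall>\<D> T. \<D> division_of T \<and> T \<subseteq> S \<and> (\<Sum>K\<in>\<D>. Sup K - Inf K) < \<delta>
        \<longrightarrow> (\<Sum>K\<in>\<D>. \<bar>f (Sup K) - f (Inf K)\<bar>) < e"
  proof (intro exI[of _ "e / (L + 1)"] conjI allI impI)
    show "e / (L + 1) > 0" using e L0 by simp
    fix \<D> T assume D: "\<D> division_of T \<and> T \<subseteq> S \<and> (\<Sum>K\<in>\<D>. Sup K - Inf K) < e / (L + 1)"
    have pos: "0 \<le> Sup K - Inf K" if "K \<in> \<D>" for K
      using division_of_real_interval[of \<D> T K] D that by (metis diff_ge_0_iff_ge)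
    have "(\<Sum>K\<in>\<D>. \<bar>f (Sup K) - f (Inf K)\<bar>) \<le> (\<Sum>K\<in>\<D>. L * (Sup K - Inf K))"
    proof (rule sum_mono)
      fix K assume "K \<in> \<D>"
      then obtain u v where K: "u \<le> v" "Inf K = u" "Sup K = v" "u \<in> T" "v \<in> T"
        using division_of_real_interval D by metis
      have "dist (f v) (f u) \<le> L * dist v u"
        using K D lipschitz_onD[OF L] by blast
      then show "\<bar>f (Sup K) - f (Inf K)\<bar> \<le> L * (Sup K - Inf K)"
        using K by (simp add: dist_real_def)
    qed
    also have "\<dots> = L * (\<Sum>K\<in>\<D>. Sup K - Inf K)" by (simp add: sum_distrib_left)
    also have "\<dots> \<le> (L + 1) * (\<Sum>K\<in>\<D>. Sup K - Inf K)"
      using sum_nonneg[of \<D> "\<lambda>K. Sup K - Inf K"] pos by (simp add: algebra_simps)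
    also have "\<dots> < e"
      using D L0 by (simp add: field_simps)
    finally show "(\<Sum>K\<in>\<D>. \<bar>f (Sup K) - f (Inf K)\<bar>) < e" .
  qed
qed

text \<open>Sums, products of bounded functions, scalar multiples and functions agreeing on \<open>S\<close> are
  all instances of this one comparison of increments.\<close>

lemma absolutely_continuous_fun_on_dominated:
  assumes f: "absolutely_continuous_fun_on S f" and g: "absolutely_continuous_fun_on S g"
    and h: "\<And>x y. x \<in> S \<Longrightarrow> y \<in> S \<Longrightarrow> \<bar>h y - h x\<bar> \<le> M * (\<bar>f y - f x\<bar> + \<bar>g y - g x\<bar>)"
  shows "absolutely_continuous_fun_on S h"
  unfolding absolutely_continuous_fun_on_def
proof (intro allI impI)
  fix e :: real assume e: "e > 0"
  define e' where "e' = e / (2 * (\<bar>M\<bar> + 1))"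
  have e': "e' > 0" using e by (simp add: e'_def add_nonneg_pos)
  obtain d1 where d1: "d1 > 0" "\<And>\<D> T. \<D> division_of T \<Longrightarrow> T \<subseteq> S \<Longrightarrow> (\<Sum>K\<in>\<D>. Sup K - Inf K) < d1
        \<Longrightarrow> (\<Sum>K\<in>\<D>. \<bar>f (Sup K) - f (Inf K)\<bar>) < e'"
    using absolutely_continuous_fun_onD[OF f e'] by metis
  obtain d2 where d2: "d2 > 0" "\<And>\<D> T. \<D> division_of T \<Longrightarrow> T \<subseteq> S \<Longrightarrow> (\<Sum>K\<in>\<D>. Sup K - Inf K) < d2
        \<Longrightarrow> (\<Sum>K\<in>\<D>. \<bar>g (Sup K) - g (Inf K)\<bar>) < e'"
    using absolutely_continuous_fun_onD[OF g e'] by metis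
  show "\<exists>\<delta>>0. \<forall>\<D> T. \<D> division_of T \<and> T \<subseteq> S \<and> (\<Sum>K\<in>\<D>. Sup K - Inf K) < \<delta>
        \<longrightarrow> (\<Sum>K\<in>\<D>. \<bar>h (Sup K) - h (Inf K)\<bar>) < e"
  proof (intro exI[of _ "min d1 d2"] conjI allI impI)
    show "min d1 d2 > 0" using d1(1) d2(1) by simp
    fix \<D> T assume D: "\<D> division_of T \<and> T \<subseteq> S \<and> (\<Sum>K\<in>\<D>. Sup K - Inf K) < min d1 d2"
    define F where "F = (\<Sum>K\<in>\<D>. \<bar>f (Sup K) - f (Inf K)\<bar>)"
    define G where "G = (\<Sum>K\<in>\<D>. \<bar>g (Sup K) - g (Inf K)\<bar>)"
    have FG: "F < e'" "G < e'" "F \<ge> 0" "G \<ge> 0"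
      using d1(2) d2(2) D by (auto simp: F_def G_def intro!: sum_nonneg)
    have "(\<Sum>K\<in>\<D>. \<bar>h (Sup K) - h (Inf K)\<bar>)
        \<le> (\<Sum>K\<in>\<D>. (\<bar>M\<bar> + 1) * (\<bar>f (Sup K) - f (Inf K)\<bar> + \<bar>g (Sup K) - g (Inf K)\<bar>))"
    proof (rule sum_mono)
      fix K assume "K \<in> \<D>"
      then obtain u v where K: "u \<le> v" "Inf K = u" "Sup K = v" "u \<in> T" "v \<in> T"
        using division_of_real_interval D by metis
      have "\<bar>h v - h u\<bar> \<le> M * (\<bar>f v - f u\<bar> + \<bar>g v - g u\<bar>)"
        using K D h by blast
      also have "\<dots> \<le> (\<bar>M\<bar> + 1) * (\<bar>f v - f u\<bar> + \<bar>g v - g u\<bar>)"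
        by (rule mult_right_mono) auto
      finally show "\<bar>h (Sup K) - h (Inf K)\<bar>
          \<le> (\<bar>M\<bar> + 1) * (\<bar>f (Sup K) - f (Inf K)\<bar> + \<bar>g (Sup K) - g (Inf K)\<bar>)"
        using K by simp
    qed
    also have "\<dots> = (\<bar>M\<bar> + 1) * (F + G)"
      by (simp add: F_def G_def sum_distrib_left sum.distrib distrib_left)
    also have "\<dots> < (\<bar>M\<bar> + 1) * (2 * e')"
      using FG by (intro mult_strict_left_mono) auto
    also have "\<dots> = e" by (simp add: e'_def field_simps add_nonneg_pos)
    finally show "(\<Sum>K\<in>\<D>. \<bar>h (Sup K) - h (Inf K)\<bar>) < e" .
  qed
qed

lemma absolutely_continuous_fun_on_add:
  assumes "absolutely_continuous_fun_on S f" "absolutely_continuous_fun_on S g"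
  shows "absolutely_continuous_fun_on S (\<lambda>x. f x + g x)"
  by (rule absolutely_continuous_fun_on_dominated[OF assms, where M = 1]) auto

lemma absolutely_continuous_fun_on_sum:
  assumes "\<And>i. i \<in> I \<Longrightarrow> absolutely_continuous_fun_on S (f i)"
  shows "absolutely_continuous_fun_on S (\<lambda>x. \<Sum>i\<in>I. f i x)"
  using assms
proof (induction I rule: infinite_finite_induct)
  case (insert i I)
  then show ?case by (simp add: absolutely_continuous_fun_on_add)
qed (auto intro!: lipschitz_imp_absolutely_continuous_fun_on[of 0] simp: lipschitz_on_def)

lemma absolutely_continuous_fun_on_mult:
  assumes "absolutely_continuous_fun_on S f" "absolutely_continuous_fun_on S g"
    and "bounded (f ` S)" "bounded (g ` S)"
  shows "absolutely_continuous_fun_on S (\<lambda>x. f x * g x)"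
proof -
  obtain A where A: "\<And>x. x \<in> S \<Longrightarrow> \<bar>f x\<bar> \<le> A" using assms(3) by (auto simp: bounded_iff)
  obtain B where B: "\<And>x. x \<in> S \<Longrightarrow> \<bar>g x\<bar> \<le> B" using assms(4) by (auto simp: bounded_iff)
  show ?thesis
  proof (rule absolutely_continuous_fun_on_dominated[OF assms(1,2), where M = "max A B"])
    fix x y assume xy: "x \<in> S" "y \<in> S"
    have "f y * g y - f x * g x = (f y - f x) * g y + f x * (g y - g x)"
      by (simp add: algebra_simps)
    also have "\<bar>\<dots>\<bar> \<le> \<bar>f y - f x\<bar> * \<bar>g y\<bar> + \<bar>f x\<bar> * \<bar>g y - g x\<bar>"
      by (metis abs_mult abs_triangle_ineq)
    also have "\<dots> \<le> \<bar>f y - f x\<bar> * max A B + max A B * \<bar>g y - g x\<bar>"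
      using A[of x] B[of y] xy by (intro add_mono mult_left_mono mult_right_mono) auto
    finally show "\<bar>f y * g y - f x * g x\<bar> \<le> max A B * (\<bar>f y - f x\<bar> + \<bar>g y - g x\<bar>)"
      by (simp add: algebra_simps)
  qed
qed

lemma absolutely_continuous_fun_on_interval_imp_continuous:
  assumes f: "absolutely_continuous_fun_on {a..b} f"
  shows "continuous_on {a..b} f"
  unfolding continuous_on_iff
proof (intro ballI allI impI)
  fix x e :: real assume x: "x \<in> {a..b}" and e: "e > 0"
  obtain d where d: "d > 0" "\<And>\<D> T. \<D> division_of T \<Longrightarrow> T \<subseteq> {a..b} \<Longrightarrow>
      (\<Sum>K\<in>\<D>. Sup K - Inf K) < d \<Longrightarrow> (\<Sum>K\<in>\<D>. \<bar>f (Sup K) - f (Inf K)\<bar>) < e"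
    using absolutely_continuous_fun_onD[OF f e] by metis
  have *: "\<bar>f v - f u\<bar> < e" if "u \<le> v" "v - u < d" "u \<in> {a..b}" "v \<in> {a..b}" for u v
    using d(2)[of "{{u..v}}" "{u..v}"] that division_of_self[of u v] by auto
  show "\<exists>d>0. \<forall>x'\<in>{a..b}. dist x' x < d \<longrightarrow> dist (f x') (f x) < e"
  proof (intro exI[of _ d] conjI ballI impI)
    fix y assume y: "y \<in> {a..b}" "dist y x < d"
    then show "dist (f y) (f x) < e"
      using *[of x y] *[of y x] x by (cases "x \<le> y") (auto simp: dist_real_def)
  qed (rule d)
qed

text \<open>A direct gauge argument, without Vitali coverings. At a tag outside \<open>N\<close>
  the gauge comes from differentiability, as in the classical case. At a tag in \<open>N\<close> it keeps the
  interval inside an open set \<open>U \<supseteq> N\<close> of small measure; the intervals with such tags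
  have small total length, and absolute continuity bounds their total increment.\<close>

lemma fundamental_theorem_of_calculus_absolutely_continuous:
  fixes f f' :: "real \<Rightarrow> real"
  assumes ab: "a \<le> b" and ac: "absolutely_continuous_fun_on {a..b} f"
    and N: "negligible N"
    and deriv: "\<And>x. x \<in> {a..b} - N \<Longrightarrow> (f has_vector_derivative f' x) (at x within {a..b})"
  shows "(f' has_integral (f b - f a)) {a..b}"
proof -
  define h where "h x = (if x \<in> N then 0 else f' x)" for x
  have "(h has_integral (f b - f a)) {a..b}"
    unfolding has_integral_real
  proof (intro allI impI)
    fix e :: real assume e: "e > 0"
    define e1 where "e1 = e / (2 * (b - a + 1))"
    have e1: "e1 > 0" using e ab by (simp add: e1_def)
    obtain \<delta> where \<delta>: "\<delta> > 0" "\<And>\<D> T. \<D> division_of T \<Longrightarrow> T \<subseteq> {a..b} \<Longrightarrow>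
        (\<Sum>K\<in>\<D>. Sup K - Inf K) < \<delta> \<Longrightarrow> (\<Sum>K\<in>\<D>. \<bar>f (Sup K) - f (Inf K)\<bar>) < e / 2"
      using absolutely_continuous_fun_onD[OF ac, of "e / 2"] e by auto
    have Nl: "N \<in> sets lebesgue" using N by (simp add: negligible_imp_sets)
    obtain U where U: "open U" "N \<subseteq> U" "U - N \<in> lmeasurable"
        "emeasure lebesgue (U - N) < ennreal \<delta>"
      using sets_lebesgue_outer_open[OF Nl \<delta>(1)] by metis
    have Um: "U \<in> lmeasurable"
      using fmeasurable.Un[OF U(3) negligible_imp_measurable[OF N]] U(2)
      by (simp add: Un_absorb2)
    have mU: "measure lebesgue U < \<delta>"
    proof -
      have "measure lebesgue U = measure lebesgue (U - N)"
        using measure_Diff_null_set[of U lebesgue N] N Um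
        by (metis fmeasurableD negligible_iff_null_sets)
      also have "\<dots> < \<delta>"
        using U(3,4) by (simp add: emeasure_eq_measure2 ennreal_less_iff)
      finally show ?thesis .
    qed
    have "\<exists>d>0. (x \<in> N \<longrightarrow> ball x d \<subseteq> U) \<and> (x \<in> {a..b} - N \<longrightarrow>
        (\<forall>y\<in>{a..b}. norm (y - x) < d \<longrightarrow> norm (f y - f x - (y - x) *\<^sub>R f' x) \<le> e1 * norm (y - x)))"
      for x
    proof (cases "x \<in> N")
      case True
      then show ?thesis using U(1,2) by (metis DiffD2 openE subsetD)
    next
      case False
      then show ?thesis
      proof (cases "x \<in> {a..b}")
        case True
        with False deriv[of x] e1 show ?thesis
          unfolding has_vector_derivative_def has_derivative_within_alt by blast
      qed (auto intro: exI[of _ 1])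
    qed
    then obtain d where d: "\<And>x. d x > 0" "\<And>x. x \<in> N \<Longrightarrow> ball x (d x) \<subseteq> U"
      "\<And>x y. x \<in> {a..b} - N \<Longrightarrow> y \<in> {a..b} \<Longrightarrow> norm (y - x) < d x
          \<Longrightarrow> norm (f y - f x - (y - x) *\<^sub>R f' x) \<le> e1 * norm (y - x)"
      by metis
    show "\<exists>\<gamma>. gauge \<gamma> \<and> (\<forall>\<D>. \<D> tagged_division_of {a..b} \<and> \<gamma> fine \<D> \<longrightarrow>
        norm ((\<Sum>(x, k)\<in>\<D>. measure lborel k *\<^sub>R h x) - (f b - f a)) < e)"
    proof (intro exI[of _ "\<lambda>x. ball x (d x)"] conjI allI impI)
      show "gauge (\<lambda>x. ball x (d x))" using d(1) by (rule gauge_ball_dependent[rule_format])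
      fix p assume "p tagged_division_of {a..b} \<and> (\<lambda>x. ball x (d x)) fine p"
      then have p: "p tagged_division_of {a..b}" and fine: "(\<lambda>x. ball x (d x)) fine p" by auto
      have finp: "finite p" using p by blast
      have tag: "\<exists>u v. u \<le> v \<and> K = {u..v} \<and> Inf K = u \<and> Sup K = v \<and> u \<le> x \<and> x \<le> v \<and>
            a \<le> u \<and> v \<le> b \<and> {u..v} \<subseteq> ball x (d x)" if xK: "(x, K) \<in> p" for x K
      proof -
        obtain u v where uv: "K = cbox u v" using tagged_division_ofD(4)[OF p xK] by blast
        have "x \<in> K" "K \<subseteq> {a..b}" using tagged_division_ofD(2,3)[OF p xK] by auto
        moreover have "K \<subseteq> ball x (d x)" using fine xK by (auto simp: fine_def)
        ultimately show ?thesis using uv by (intro exI[of _ u] exI[of _ v]) auto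
      qed
      define \<Delta> where "\<Delta> K = f (Sup K) - f (Inf K)" for K
      define p1 where "p1 = {(x, K) \<in> p. x \<in> N}"
      define p2 where "p2 = {(x, K) \<in> p. x \<notin> N}"
      have pp: "p = p1 \<union> p2" "p1 \<inter> p2 = {}" "finite p1" "finite p2" "p1 \<subseteq> p" "p2 \<subseteq> p"
        using finite_subset[OF _ finp, of p1] finite_subset[OF _ finp, of p2] by (auto simp: p1_def p2_def)
      have "(\<Sum>(x, K)\<in>p. measure lborel K *\<^sub>R h x) - (f b - f a)
          = (\<Sum>(x, K)\<in>p. measure lborel K *\<^sub>R h x - \<Delta> K)"
        using additive_tagged_division_1[OF ab p, of f]
        by (simp add: \<Delta>_def sum_subtractf case_prod_unfold)
      also have "\<dots> = (\<Sum>(x, K)\<in>p1. measure lborel K *\<^sub>R h x - \<Delta> K) + (\<Sum>(x, K)\<in>p2. measure lborel K *\<^sub>R h x - \<Delta> K)"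
        unfolding pp(1) by (rule sum.union_disjoint[OF pp(3,4,2)])
      also have "(\<Sum>(x, K)\<in>p1. measure lborel K *\<^sub>R h x - \<Delta> K) = (\<Sum>(x, K)\<in>p1. - \<Delta> K)"
        by (rule sum.cong) (auto simp: p1_def h_def)
      finally have eq: "(\<Sum>(x, K)\<in>p. measure lborel K *\<^sub>R h x) - (f b - f a)
          = (\<Sum>(x, K)\<in>p1. - \<Delta> K) + (\<Sum>(x, K)\<in>p2. measure lborel K *\<^sub>R h x - \<Delta> K)" .
      have B2: "\<bar>\<Sum>(x, K)\<in>p2. measure lborel K *\<^sub>R h x - \<Delta> K\<bar> \<le> e / 2"
      proof -
        have "\<bar>\<Sum>(x, K)\<in>p2. measure lborel K *\<^sub>R h x - \<Delta> K\<bar> \<le> (\<Sum>(x, K)\<in>p2. e1 * (Sup K - Inf K))"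
          unfolding real_norm_def[symmetric]
        proof (rule sum_norm_le, clarify)
          fix x K assume xK: "(x, K) \<in> p2"
          then have "(x, K) \<in> p" and xN: "x \<notin> N" by (auto simp: p2_def)
          then obtain u v where uv: "u \<le> v" "K = {u..v}" "Inf K = u" "Sup K = v" "u \<le> x" "x \<le> v"
              "a \<le> u" "v \<le> b" "{u..v} \<subseteq> ball x (d x)"
            using tag by metis
          have "norm (u - x) < d x" "norm (v - x) < d x"
            using uv(1) subsetD[OF uv(9), of u] subsetD[OF uv(9), of v] by (auto simp: dist_real_def)
          then have "norm (f u - f x - (u - x) *\<^sub>R f' x) \<le> e1 * norm (u - x)"
                    "norm (f v - f x - (v - x) *\<^sub>R f' x) \<le> e1 * norm (v - x)"
            using d(3)[of x u] d(3)[of x v] xN uv by auto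
          then have "\<bar>(v - u) * f' x - (f v - f u)\<bar> \<le> e1 * (x - u) + e1 * (v - x)"
            using uv by (simp add: algebra_simps abs_if split: if_splits)
          then show "norm (measure lborel K *\<^sub>R h x - \<Delta> K) \<le> e1 * (Sup K - Inf K)"
            using uv xN by (simp add: h_def \<Delta>_def algebra_simps)
        qed
        also have "\<dots> \<le> (\<Sum>(x, K)\<in>p. e1 * (Sup K - Inf K))"
        proof (rule sum_mono2[OF finp pp(6)])
          fix z assume "z \<in> p - p2"
          then show "0 \<le> (case z of (x, K) \<Rightarrow> e1 * (Sup K - Inf K))"
            using tag[of "fst z" "snd z"] e1 by (cases z) auto
        qed
        also have "\<dots> = e1 * (b - a)"
          using additive_tagged_division_1[OF ab p, of "\<lambda>x. x"]
          by (simp add: sum_distrib_left[symmetric] case_prod_unfold)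
        also have "\<dots> \<le> e / 2"
          using e ab by (simp add: e1_def field_simps)
        finally show ?thesis .
      qed
      have B1: "\<bar>\<Sum>(x, K)\<in>p1. - \<Delta> K\<bar> < e / 2"
      proof -
        have "p tagged_partial_division_of {a..b}"
          using p by (simp add: tagged_division_of_def)
        then have pd: "p1 tagged_partial_division_of {a..b}"
          using pp(5) by (rule tagged_partial_division_subset)
        have td: "p1 tagged_division_of \<Union>(snd ` p1)"
          by (rule tagged_partial_division_of_Union_self[OF pd])
        have dv: "snd ` p1 division_of \<Union>(snd ` p1)"
          by (rule division_of_tagged_division[OF td])
        have K1: "K \<subseteq> {a..b} \<and> K \<subseteq> U \<and> Sup K - Inf K = measure lebesgue K"
          if "(x, K) \<in> p1" for x K
        proof -
          have "(x, K) \<in> p" "x \<in> N" using that by (auto simp: p1_def)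
          then obtain u v where uv: "u \<le> v" "K = {u..v}" "Inf K = u" "Sup K = v"
              "a \<le> u" "v \<le> b" "{u..v} \<subseteq> ball x (d x)"
            using tag by metis
          then show ?thesis using d(2)[OF \<open>x \<in> N\<close>] by auto
        qed
        have sub: "\<Union>(snd ` p1) \<subseteq> {a..b}" and subU: "\<Union>(snd ` p1) \<subseteq> U"
          using K1 by fastforce+
        have "(\<Sum>K\<in>snd ` p1. Sup K - Inf K) = (\<Sum>K\<in>snd ` p1. measure lebesgue K)"
        proof (rule sum.cong[OF refl])
          fix K assume "K \<in> snd ` p1"
          then obtain x where "(x, K) \<in> p1" by auto
          then show "Sup K - Inf K = measure lebesgue K" using K1 by blast
        qed
        also have "\<dots> = measure lebesgue (\<Union>(snd ` p1))" by (rule content_division[OF dv])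
        also have "\<dots> \<le> measure lebesgue U"
          by (rule measure_mono_fmeasurable[OF subU _ Um]) (rule fmeasurableD[OF lmeasurable_division[OF dv]])
        also have "\<dots> < \<delta>" by (rule mU)
        finally have "(\<Sum>K\<in>snd ` p1. \<bar>\<Delta> K\<bar>) < e / 2"
          using \<delta>(2)[OF dv sub] by (simp add: \<Delta>_def)
        \<comment> \<open>Two tags can share an interval only if it is degenerate, and then its increment is \<open>0\<close>.\<close>
        moreover have "(\<Sum>(x, K)\<in>p1. \<bar>\<Delta> K\<bar>) = (\<Sum>K\<in>snd ` p1. \<bar>\<Delta> K\<bar>)"
        proof -
          \<comment> \<open>The increment of the empty interval is \<open>f (Sup {}) - f (Inf {})\<close>, not known to be \<open>0\<close>.\<close>
          define \<Delta>' where "\<Delta>' K = (if K = {} then 0 else \<bar>\<Delta> K\<bar>)" for K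
          have ne: "K \<noteq> {}" if "(x, K) \<in> p1" for x K
            using tagged_division_ofD(2)[OF td that] by auto
          have "(\<Sum>(x, K)\<in>p1. \<bar>\<Delta> K\<bar>) = (\<Sum>(x, K)\<in>p1. \<Delta>' K)"
            using ne by (intro sum.cong) (auto simp: \<Delta>'_def)
          also have "\<dots> = (\<Sum>K\<in>snd ` p1. \<Delta>' K)"
            using td
          proof (rule sum.over_tagged_division_lemma)
            fix u v :: real assume "box u v = {}"
            then have "v \<le> u" by (simp add: box_eq_empty)
            then show "\<Delta>' (cbox u v) = 0"
              by (cases "u = v") (auto simp: \<Delta>_def \<Delta>'_def)
          qed
          also have "\<dots> = (\<Sum>K\<in>snd ` p1. \<bar>\<Delta> K\<bar>)"
            using ne by (intro sum.cong) (auto simp: \<Delta>'_def)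
          finally show ?thesis .
        qed
        moreover have "\<bar>\<Sum>(x, K)\<in>p1. - \<Delta> K\<bar> \<le> (\<Sum>(x, K)\<in>p1. \<bar>\<Delta> K\<bar>)"
          using sum_abs[of "\<lambda>(x, K). - \<Delta> K" p1] by (simp add: case_prod_unfold)
        ultimately show ?thesis by simp
      qed
      show "norm ((\<Sum>(x, k)\<in>p. measure lborel k *\<^sub>R h x) - (f b - f a)) < e"
        unfolding eq using B1 B2 by simp
    qed
  qed
  then show ?thesis
    by (rule has_integral_spike[OF N, rotated]) (auto simp: h_def)
qed

section \<open>Derivatives of polynomials and Hermite interpolation\<close>

lemma higher_pderiv_root:
  fixes p :: "'a::idom poly"
  assumes "[:- c, 1:] ^ m dvd p" "j < m"
  shows "poly ((pderiv ^^ j) p) c = 0"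
proof -
  have "[:- c, 1:] ^ (m - j) dvd (pderiv ^^ j) p"
    using less_imp_le[OF assms(2)]
  proof (induction j)
    case 0
    then show ?case using assms(1) by simp
  next
    case (Suc j)
    then obtain q where q: "(pderiv ^^ j) p = [:- c, 1:] ^ Suc (m - Suc j) * q"
      by (auto simp: Suc_diff_Suc elim!: dvdE)
    show ?case
      unfolding funpow.simps comp_def q pderiv_mult pderiv_power_Suc
      by (intro dvd_add dvd_mult2[OF le_imp_power_dvd] dvd_mult[OF dvd_mult2[OF dvd_smult]]) auto
  qed
  moreover have "[:- c, 1:] dvd [:- c, 1:] ^ (m - j)"
    using assms(2) by (simp add: dvd_power)
  ultimately have "[:- c, 1:] dvd (pderiv ^^ j) p" by (rule dvd_trans[rotated])
  then show ?thesis by (simp add: poly_eq_0_iff_dvd)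
qed

lemma higher_pderiv_eq_0:
  fixes p :: "'a::{comm_semiring_1,semiring_no_zero_divisors} poly"
  assumes "degree p < m"
  shows "(pderiv ^^ m) p = 0"
  using assms by (intro poly_eqI) (simp add: coeff_higher_pderiv coeff_eq_0)

definition taylor_monom :: "real \<Rightarrow> nat \<Rightarrow> real poly" where
  "taylor_monom a i = smult (1 / fact i) ([:- a, 1:] ^ i)"

lemma poly_taylor_monom: "poly (taylor_monom a i) x = (x - a) ^ i / fact i"
  by (simp add: taylor_monom_def)

lemma degree_taylor_monom: "degree (taylor_monom a i) = i"
  by (simp add: taylor_monom_def degree_linear_power)

lemma pderiv_taylor_monom_Suc: "pderiv (taylor_monom a (Suc i)) = taylor_monom a i"
  unfolding taylor_monom_def pderiv_smult pderiv_power_Suc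
  by (simp add: pderiv_pCons field_simps del: of_nat_Suc)

lemma higher_pderiv_taylor_monom:
  "(pderiv ^^ j) (taylor_monom a (i + j)) = taylor_monom a i"
proof (induction j arbitrary: i)
  case (Suc j)
  from Suc[of "Suc i"] show ?case by (simp add: pderiv_taylor_monom_Suc)
qed simp

lemma higher_pderiv_taylor_monom_at_centre:
  "poly ((pderiv ^^ j) (taylor_monom a i)) a = (if j = i then 1 else 0)"
proof (cases "j \<le> i")
  case True
  then show ?thesis
    using higher_pderiv_taylor_monom[of j a "i - j"] by (auto simp: poly_taylor_monom)
next
  case False
  then show ?thesis by (simp add: higher_pderiv_eq_0 degree_taylor_monom)
qed

lemma bezout_identity_powers:
  fixes x y :: "'a::comm_ring_1"
  assumes "u * x + v * y = 1"
  obtains u' v' where "u' * x ^ m + v' * y ^ n = 1"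
proof -
  have power: "\<exists>u' v'. u' * x ^ m + v' * y = 1" if "u * x + v * y = 1" for u v x y :: 'a and m
  proof (induction m)
    case 0
    then show ?case by (intro exI[of _ 1] exI[of _ 0]) simp
  next
    case (Suc m)
    then obtain u' v' where "u' * x ^ m + v' * y = 1" by blast
    then have "(u * x + v * y) * (u' * x ^ m + v' * y) = 1" using that by simp
    then have "(u * u') * x ^ Suc m + (u * x * v' + v * u' * x ^ m + v * y * v') * y = 1"
      by (simp add: algebra_simps)
    then show ?case by blast
  qed
  obtain u1 v1 where "u1 * x ^ m + v1 * y = 1" using power[OF assms] by blast
  then have "v1 * y + u1 * x ^ m = 1" by (simp add: add.commute)
  then obtain u2 v2 where "u2 * y ^ n + v2 * x ^ m = 1" using power by blast
  then show thesis by (intro that[of v2 u2]) (simp add: add.commute)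
qed

text \<open>Chinese remaindering modulo \<open>x\<^sup>n\<close> and \<open>(x-1)\<^sup>n\<close>. In terms of derivatives (\<open>higher_pderiv_root\<close>):
  \<open>P\<close> takes the initial data of \<open>- T\<close> at \<open>0\<close> and zero data at \<open>1\<close>.\<close>

lemma hermite_two_point:
  fixes T :: "real poly"
  assumes "n > 0"
  obtains P where "degree P < 2 * n" "[:0, 1:] ^ n dvd T + P" "[:- 1, 1:] ^ n dvd P"
proof -
  define X Y :: "real poly" where "X = [:0, 1:] ^ n" and "Y = [:- 1, 1:] ^ n"
  have "1 * [:0, 1:] + (- 1) * [:- 1, 1:] = (1 :: real poly)" by (simp add: one_pCons)
  then obtain U V where UV: "U * X + V * Y = 1"
    unfolding X_def Y_def using bezout_identity_powers by metis
  define P where "P = (- T * V * Y) mod (X * Y)"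
  have XY: "X * Y \<noteq> 0" "degree (X * Y) = 2 * n"
    by (auto simp: X_def Y_def degree_mult_eq degree_linear_power)
  obtain R where R: "P = - T * V * Y - R * (X * Y)"
    unfolding P_def by (metis minus_div_mult_eq_mod)
  have "degree P < 2 * n"
    using degree_mod_less[OF XY(1), of "- T * V * Y"] XY(2) assms by (auto simp: P_def)
  moreover have "T + P = X * (T * U - R * Y)"
  proof -
    have "T + P = T * (1 - V * Y) - R * (X * Y)" by (simp add: R algebra_simps)
    also have "1 - V * Y = U * X" using UV by (simp add: algebra_simps)
    finally show ?thesis by (simp add: algebra_simps)
  qed
  then have "X dvd T + P" by simp
  moreover have "Y dvd P" unfolding R by (intro dvd_diff) auto
  ultimately show thesis using that by (simp add: X_def Y_def)
qed

section \<open>Iterated derivatives of polynomial splines\<close>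

lemma nth_deriv_0: "nth_deriv 0 y = y"
  by (simp add: nth_deriv_def)

lemma nth_deriv_Suc: "nth_deriv (Suc j) y x = vector_derivative (nth_deriv j y) (at x within {0..1})"
  by (simp add: nth_deriv_def)

lemma has_vector_derivative_nth_deriv:
  assumes "nth_deriv j y differentiable (at x within {0..1})"
  shows "(nth_deriv j y has_vector_derivative nth_deriv (Suc j) y x) (at x within {0..1})"
  using assms by (simp add: nth_deriv_Suc vector_derivative_works)

text \<open>Outside \<open>[0,1]\<close> the iterated derivatives are unspecified, so two functions are
  only ever compared on \<open>[0,1]\<close>; this lemma and the next are the corresponding congruence rules.\<close>

lemma nth_deriv_Suc_cong:
  assumes "\<And>t. t \<in> {0..1} \<Longrightarrow> nth_deriv j y t = nth_deriv j z t" and x: "x \<in> {0..1}"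
  shows "nth_deriv (Suc j) y x = nth_deriv (Suc j) z x"
proof -
  have "(nth_deriv j y has_vector_derivative D) (at x within {0..1}) \<longleftrightarrow>
        (nth_deriv j z has_vector_derivative D) (at x within {0..1})" for D
    using has_vector_derivative_transform[OF x] assms(1) by metis
  then show ?thesis by (simp add: nth_deriv_Suc vector_derivative_def)
qed

lemma nth_deriv_Suc_eqI:
  assumes D: "\<And>t. t \<in> {0..1} \<Longrightarrow> nth_deriv j y t = D t" and x: "x \<in> {0..1}"
    and "(D has_vector_derivative D') (at x within {0..1})"
  shows "(nth_deriv j y has_vector_derivative D') (at x within {0..1})"
    and "nth_deriv (Suc j) y x = D'"
proof -
  show 1: "(nth_deriv j y has_vector_derivative D') (at x within {0..1})"
    using has_vector_derivative_transform[OF x D assms(3)] .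
  show "nth_deriv (Suc j) y x = D'"
    using vector_derivative_within_closed_interval[OF zero_less_one x 1] by (simp add: nth_deriv_Suc)
qed

definition spline :: "real poly \<Rightarrow> real poly \<Rightarrow> real \<Rightarrow> real \<Rightarrow> real" where
  "spline A B a x = (if x \<le> a then poly A x else poly B x)"

lemma poly_has_vector_derivative:
  "(poly p has_vector_derivative poly (pderiv p) x) (at x within S)" for p :: "real poly"
  using poly_DERIV[of p x] has_field_derivative_at_within has_real_derivative_iff_has_vector_derivative
  by blast

lemma spline_has_vector_derivative:
  assumes "x = a \<Longrightarrow> poly A a = poly B a \<and> poly (pderiv A) a = poly (pderiv B) a"
  shows "(spline A B a has_vector_derivative spline (pderiv A) (pderiv B) a x) (at x within S)"
proof -
  consider "x < a" | "x > a" | "x = a" by linarith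
  then have "(spline A B a has_vector_derivative spline (pderiv A) (pderiv B) a x) (at x)"
  proof cases
    case 1
    then show ?thesis
      using has_vector_derivative_transform_within_open[of "poly A" _ x "{..<a}" "spline A B a"]
        poly_has_vector_derivative[of A x UNIV] by (simp add: spline_def)
  next
    case 2
    then show ?thesis
      using has_vector_derivative_transform_within_open[of "poly B" _ x "{a<..}" "spline A B a"]
        poly_has_vector_derivative[of B x UNIV] by (simp add: spline_def)
  next
    case 3
    have "((\<lambda>x. if x \<in> {..a} then poly A x else poly B x) has_vector_derivative
        (if x \<in> {..a} then poly (pderiv A) x else poly (pderiv B) x)) (at x within UNIV)"
      by (rule has_vector_derivative_If_within_closures[where T = "{a<..}"];
          (rule poly_has_vector_derivative | use 3 assms in auto))
    then show ?thesis by (simp add: spline_def[abs_def])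
  qed
  then show ?thesis by (rule has_vector_derivative_at_within)
qed

lemma poly_lipschitz:
  fixes p :: "real poly"
  obtains L where "L-lipschitz_on {u..v} (poly p)"
proof -
  have "bounded (poly (pderiv p) ` {u..v})"
    by (intro compact_imp_bounded compact_continuous_image continuous_intros) auto
  then obtain C where C: "C > 0" "\<And>x. x \<in> {u..v} \<Longrightarrow> \<bar>poly (pderiv p) x\<bar> \<le> C"
    by (auto simp: bounded_pos)
  have "C-lipschitz_on {u..v} (poly p)"
  proof (rule bounded_derivative_imp_lipschitz)
    fix x assume x: "x \<in> {u..v}"
    show "(poly p has_derivative (\<lambda>h. h *\<^sub>R poly (pderiv p) x)) (at x within {u..v})"
      using poly_has_vector_derivative by (simp add: has_vector_derivative_def)
    show "onorm (\<lambda>h. h *\<^sub>R poly (pderiv p) x) \<le> C"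
      using C(2)[OF x] by (intro onorm_le) (simp add: abs_mult mult.commute[of C] mult_left_mono)
  qed (use C in auto)
  then show thesis using that by blast
qed

lemma spline_absolutely_continuous:
  assumes "poly A a = poly B a"
  shows "absolutely_continuous_fun_on {u..v} (spline A B a)"
proof -
  obtain L where L: "L-lipschitz_on {u..a} (poly A)" using poly_lipschitz .
  obtain M where M: "M-lipschitz_on {a..v} (poly B)" using poly_lipschitz .
  have "(max L M)-lipschitz_on {u..v} (spline A B a)"
    using lipschitz_on_concat_max[OF L M assms] by (simp add: spline_def[abs_def])
  then show ?thesis by (rule lipschitz_imp_absolutely_continuous_fun_on)
qed

context
  fixes A B :: "real poly" and a :: real and n :: nat
  assumes agree: "\<And>j. j < n \<Longrightarrow> poly ((pderiv ^^ j) A) a = poly ((pderiv ^^ j) B) a"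
begin

lemma nth_deriv_spline:
  assumes "j < n" "x \<in> {0..1}"
  shows "nth_deriv j (spline A B a) x = spline ((pderiv ^^ j) A) ((pderiv ^^ j) B) a x"
  using assms
proof (induction j arbitrary: x)
  case (Suc j)
  show ?case
    by (rule nth_deriv_Suc_eqI(2)[OF Suc.IH])
      (use Suc.prems agree[of j] agree[of "Suc j"] in
        \<open>auto simp del: funpow.simps simp: funpow.simps(2)[THEN fun_cong, unfolded comp_def]
          intro!: spline_has_vector_derivative\<close>)
qed (simp add: nth_deriv_0)

lemma nth_deriv_spline_differentiable:
  assumes "j < n" "x \<in> {0..1}" "Suc j < n \<or> x \<noteq> a"
  shows "(nth_deriv j (spline A B a) has_vector_derivative
            spline ((pderiv ^^ Suc j) A) ((pderiv ^^ Suc j) B) a x) (at x within {0..1})"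
    and "nth_deriv (Suc j) (spline A B a) x = spline ((pderiv ^^ Suc j) A) ((pderiv ^^ Suc j) B) a x"
proof -
  have "(spline ((pderiv ^^ j) A) ((pderiv ^^ j) B) a has_vector_derivative
          spline ((pderiv ^^ Suc j) A) ((pderiv ^^ Suc j) B) a x) (at x within {0..1})"
    using spline_has_vector_derivative[of x a "(pderiv ^^ j) A" "(pderiv ^^ j) B" "{0..1}"]
      assms(1,3) agree[of j] agree[of "Suc j"] by auto
  from nth_deriv_Suc_eqI[OF nth_deriv_spline assms(2) this] assms(1)
  show "(nth_deriv j (spline A B a) has_vector_derivative
            spline ((pderiv ^^ Suc j) A) ((pderiv ^^ Suc j) B) a x) (at x within {0..1})"
    and "nth_deriv (Suc j) (spline A B a) x = spline ((pderiv ^^ Suc j) A) ((pderiv ^^ Suc j) B) a x"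
    by auto
qed

lemma spline_in_sobolev0:
  assumes a: "a \<in> {0<..<1}" and n: "n \<ge> 1"
    and A0: "\<And>j. j < n \<Longrightarrow> poly ((pderiv ^^ j) A) 0 = 0"
    and B1: "\<And>j. j < n \<Longrightarrow> poly ((pderiv ^^ j) B) 1 = 0"
  shows "spline A B a \<in> sobolev0 n"
proof -
  let ?g = "spline A B a"
  define An Bn where "An = (pderiv ^^ n) A" and "Bn = (pderiv ^^ n) B"
  \<comment> \<open>At the knot \<open>a\<close> the \<open>n\<close>-th derivative need not exist and its value \<open>c\<close> is unspecified.\<close>
  define c where "c = nth_deriv n ?g a"
  define u where "u x = (if x = a then c else spline An Bn a x)" for x
  have gn: "nth_deriv n ?g x = u x" if "x \<in> {0..1}" for x
    using nth_deriv_spline_differentiable(2)[of "n - 1" x] n that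
    by (auto simp: u_def c_def An_def Bn_def simp del: funpow.simps)
  have "spline An Bn a = (\<lambda>x. if x \<in> {..a} then poly An x else poly Bn x)"
    by (auto simp: spline_def)
  also have "\<dots> \<in> borel_measurable borel"
    by (intro measurable_If_set borel_measurable_continuous_onI continuous_intros) auto
  finally have [measurable]: "spline An Bn a \<in> borel_measurable borel" .
  have "u \<in> borel_measurable borel" unfolding u_def by measurable
  then have um: "u \<in> borel_measurable (lebesgue_on {0..1})"
    by (simp add: measurable_completion measurable_restrict_space1)
  have "bounded (poly An ` {0..1})" "bounded (poly Bn ` {0..1})"
    by (intro compact_imp_bounded compact_continuous_image continuous_intros; simp)+
  then obtain K1 K2 where K: "\<forall>x\<in>{0..1}. \<bar>poly An x\<bar> \<le> K1" "\<forall>x\<in>{0..1}. \<bar>poly Bn x\<bar> \<le> K2"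
    unfolding bounded_iff by auto
  have ub: "\<bar>u x\<bar> \<le> max \<bar>c\<bar> (max K1 K2)" if "x \<in> {0..1}" for x
    using K that by (fastforce simp: u_def spline_def)
  have int: "integrable (lebesgue_on {0..1}) (\<lambda>x. (u x)\<^sup>2)"
  proof (rule finite_measure.integrable_const_bound)
    show "finite_measure (lebesgue_on {0..1::real})" by (rule finite_measure_lebesgue_on) simp
    show "AE x in lebesgue_on {0..1}. norm ((u x)\<^sup>2) \<le> (max \<bar>c\<bar> (max K1 K2))\<^sup>2"
      using ub by (intro AE_I2) (auto simp: abs_le_square_iff[symmetric])
  qed (use um in measurable)
  show ?thesis
    unfolding sobolev0_def
  proof (intro CollectI conjI allI impI ballI)
    fix j x assume "j < n - 1" "x \<in> {0..1::real}"
    then show "nth_deriv j ?g differentiable (at x within {0..1})"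
      by (intro differentiableI_vector[OF nth_deriv_spline_differentiable(1)]) auto
  next
    fix j assume j: "j < n"
    have ac: "absolutely_continuous_fun_on {0..1} (spline ((pderiv ^^ j) A) ((pderiv ^^ j) B) a)"
      using spline_absolutely_continuous agree[OF j] .
    show "absolutely_continuous_fun_on {0..1} (nth_deriv j ?g)"
      using nth_deriv_spline[OF j]
      by (intro absolutely_continuous_fun_on_dominated[where M = 1 and h = "nth_deriv j ?g", OF ac ac]) auto
    show "nth_deriv j ?g 0 = 0" "nth_deriv j ?g 1 = 0"
      using nth_deriv_spline[OF j] A0[OF j] B1[OF j] a by (auto simp: spline_def)
  next
    have "{a} \<in> null_sets lebesgue" by (simp add: null_sets_completionI)
    then have "AE x in lebesgue. x \<noteq> a" by (rule AE_I'[of "{a}"]) auto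
    then have "AE x in lebesgue_on {0..1}. x \<noteq> a"
      by (subst AE_restrict_space_iff) auto
    then show "AE x in lebesgue_on {0..1}. nth_deriv (n - 1) ?g differentiable (at x within {0..1})"
    proof (rule lebesgue_on_mono)
      fix x assume "x \<noteq> a" "x \<in> {0..1::real}"
      then show "nth_deriv (n - 1) ?g differentiable (at x within {0..1})"
        using n by (intro differentiableI_vector[OF nth_deriv_spline_differentiable(1)]) auto
    qed
  next
    show "nth_deriv n ?g \<in> borel_measurable (lebesgue_on {0..1})"
      using um by (subst measurable_cong[of _ _ u]) (auto simp: gn)
    show "integrable (lebesgue_on {0..1}) (\<lambda>x. (nth_deriv n ?g x)\<^sup>2)"
      using int by (subst Bochner_Integration.integrable_cong[OF refl, of _ _ "\<lambda>x. (u x)\<^sup>2"]) (auto simp: gn)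
  qed
qed

end

section \<open>Integration by parts in the Sobolev space\<close>

lemma poly_absolutely_continuous: "absolutely_continuous_fun_on {u..v} (poly p)" for p :: "real poly"
  using poly_lipschitz lipschitz_imp_absolutely_continuous_fun_on by metis

lemma integrable_mult_of_square_integrable:
  fixes f g :: "'a \<Rightarrow> real"
  assumes [measurable]: "f \<in> borel_measurable M" "g \<in> borel_measurable M"
    and "integrable M (\<lambda>x. (f x)\<^sup>2)" "integrable M (\<lambda>x. (g x)\<^sup>2)"
  shows "integrable M (\<lambda>x. f x * g x)"
proof (rule Bochner_Integration.integrable_bound)
  show "integrable M (\<lambda>x. (f x)\<^sup>2 + (g x)\<^sup>2)" using assms by simp
  have "\<bar>f x * g x\<bar> \<le> (f x)\<^sup>2 + (g x)\<^sup>2" for x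
    using sum_squares_bound[of "\<bar>f x\<bar>" "\<bar>g x\<bar>"] mult_nonneg_nonneg[OF abs_ge_zero abs_ge_zero, of "f x" "g x"]
    unfolding abs_mult power2_abs by linarith
  then show "AE x in M. norm (f x * g x) \<le> norm ((f x)\<^sup>2 + (g x)\<^sup>2)" by simp
qed simp

lemma sobolev0_mult_integrable:
  assumes "f \<in> sobolev0 n" "g \<in> sobolev0 n"
  shows "integrable (lebesgue_on {0..1}) (\<lambda>x. nth_deriv n f x * nth_deriv n g x)"
  using assms by (intro integrable_mult_of_square_integrable) (auto simp: sobolev0_def)

lemma sobolev0_has_vector_derivative:
  assumes f: "f \<in> sobolev0 n" and n: "n \<ge> 1"
  obtains N where "negligible N"
    "\<And>j x. j < n \<Longrightarrow> x \<in> {0..1} - N \<Longrightarrow>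
      (nth_deriv j f has_vector_derivative nth_deriv (Suc j) f x) (at x within {0..1})"
proof -
  have "AE x in lebesgue_on {0..1}. nth_deriv (n - 1) f differentiable (at x within {0..1})"
    using f by (simp add: sobolev0_def)
  then have "AE x in lebesgue. x \<in> {0..1} \<longrightarrow> nth_deriv (n - 1) f differentiable (at x within {0..1})"
    by (subst (asm) AE_restrict_space_iff) auto
  then obtain N where N: "N \<in> null_sets lebesgue"
      "{x. \<not> (x \<in> {0..1} \<longrightarrow> nth_deriv (n - 1) f differentiable (at x within {0..1}))} \<subseteq> N"
    by (auto simp: eventually_ae_filter)
  show thesis
  proof (rule that)
    show "negligible N" using N(1) by (simp add: negligible_iff_null_sets)
    fix j x assume j: "j < n" and x: "x \<in> {0..1} - N"
    have "nth_deriv j f differentiable (at x within {0..1})"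
    proof (cases "j = n - 1")
      case True
      then show ?thesis using N(2) x by auto
    next
      case False
      then show ?thesis using f j x by (auto simp: sobolev0_def)
    qed
    then show "(nth_deriv j f has_vector_derivative nth_deriv (Suc j) f x) (at x within {0..1})"
      by (rule has_vector_derivative_nth_deriv)
  qed
qed

text \<open>The boundary term of \<open>n\<close>-fold integration by parts in \<open>\<integral> f\<^sup>(\<^sup>n\<^sup>) p\<close>.\<close>

definition parts_sum :: "nat \<Rightarrow> (real \<Rightarrow> real) \<Rightarrow> real poly \<Rightarrow> real \<Rightarrow> real" where
  "parts_sum n f p x =
     (\<Sum>j<n. (- 1) ^ j * (nth_deriv (n - Suc j) f x * poly ((pderiv ^^ j) p) x))"

text \<open>The derivative of \<open>parts_sum\<close> telescopes to \<open>f\<^sup>(\<^sup>n\<^sup>) p \<plusminus> f p\<^sup>(\<^sup>n\<^sup>)\<close>, and \<open>p\<^sup>(\<^sup>n\<^sup>) = 0\<close>. It exists only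
  almost everywhere, hence the appeal to absolute continuity.\<close>

lemma sobolev0_integration_by_parts:
  assumes f: "f \<in> sobolev0 n" and n: "n \<ge> 1" and p: "degree p < n"
    and cd: "0 \<le> c" "c \<le> d" "d \<le> 1"
  shows "((\<lambda>x. nth_deriv n f x * poly p x) has_integral (parts_sum n f p d - parts_sum n f p c)) {c..d}"
proof -
  obtain N where N: "negligible N"
    "\<And>j x. j < n \<Longrightarrow> x \<in> {0..1} - N \<Longrightarrow>
      (nth_deriv j f has_vector_derivative nth_deriv (Suc j) f x) (at x within {0..1})"
    using sobolev0_has_vector_derivative[OF f n] by blast
  show ?thesis
  proof (rule fundamental_theorem_of_calculus_absolutely_continuous[OF cd(2) _ N(1)])
    show "absolutely_continuous_fun_on {c..d} (parts_sum n f p)"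
      unfolding parts_sum_def[abs_def]
    proof (rule absolutely_continuous_fun_on_sum)
      fix j assume j: "j \<in> {..<n}"
      have ac: "absolutely_continuous_fun_on {c..d} (nth_deriv (n - Suc j) f)"
        by (rule absolutely_continuous_fun_on_subset[of "{0..1}"]) (use j cd f in \<open>auto simp: sobolev0_def\<close>)
      have ac': "absolutely_continuous_fun_on {c..d} (poly ((pderiv ^^ j) p))"
        by (rule poly_absolutely_continuous)
      have bdd: "bounded (h ` {c..d})" if "absolutely_continuous_fun_on {c..d} h" for h
        using absolutely_continuous_fun_on_interval_imp_continuous[OF that]
        by (intro compact_imp_bounded compact_continuous_image) auto
      have "absolutely_continuous_fun_on {c..d} (\<lambda>x. nth_deriv (n - Suc j) f x * poly ((pderiv ^^ j) p) x)"
        by (rule absolutely_continuous_fun_on_mult[OF ac ac' bdd[OF ac] bdd[OF ac']])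
      from this this show "absolutely_continuous_fun_on {c..d}
          (\<lambda>x. (- 1) ^ j * (nth_deriv (n - Suc j) f x * poly ((pderiv ^^ j) p) x))"
        by (rule absolutely_continuous_fun_on_dominated[where M = 1])
          (simp add: right_diff_distrib[symmetric] abs_mult power_abs)
    qed
  next
    fix x assume x: "x \<in> {c..d} - N"
    define S where "S j = (- 1) ^ j * (nth_deriv (n - j) f x * poly ((pderiv ^^ j) p) x)" for j
    have "((\<lambda>x. (- 1) ^ j * (nth_deriv (n - Suc j) f x * poly ((pderiv ^^ j) p) x))
        has_vector_derivative S j - S (Suc j)) (at x within {c..d})" if j: "j < n" for j
    proof -
      have *: "Suc (n - Suc j) = n - j" using j by simp
      have "(nth_deriv (n - Suc j) f has_vector_derivative nth_deriv (n - j) f x) (at x within {c..d})"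
        using has_vector_derivative_within_subset[OF N(2)[of "n - Suc j" x], of "{c..d}"] x cd j
        unfolding * by auto
      moreover have "(poly ((pderiv ^^ j) p) has_vector_derivative poly ((pderiv ^^ Suc j) p) x) (at x within {c..d})"
        using poly_has_vector_derivative by simp
      ultimately show ?thesis
        unfolding has_real_derivative_iff_has_vector_derivative[symmetric]
        by (auto intro!: derivative_eq_intros simp: S_def algebra_simps)
    qed
    then have "(parts_sum n f p has_vector_derivative (\<Sum>j<n. S j - S (Suc j))) (at x within {c..d})"
      unfolding parts_sum_def[abs_def] by (intro has_vector_derivative_sum) auto
    also have "(\<Sum>j<n. S j - S (Suc j)) = nth_deriv n f x * poly p x"
      unfolding sum_lessThan_telescope' by (simp add: S_def higher_pderiv_eq_0[OF p])
    finally show "(parts_sum n f p has_vector_derivative nth_deriv n f x * poly p x) (at x within {c..d})" .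
  qed
qed

lemma parts_sum_endpoints:
  assumes "f \<in> sobolev0 n" "x \<in> {0, 1}"
  shows "parts_sum n f p x = 0"
  using assms by (auto simp: parts_sum_def sobolev0_def)

text \<open>The power \<open>(a - x)\<^sup>m / m!\<close> with \<open>m = n-1-k\<close> has \<open>m\<close>-th derivative \<open>(-1)\<^sup>m\<close>, and all its other
  derivatives vanish at \<open>a\<close>, so one boundary term survives there. This is Taylor's formula with
  integral remainder for \<open>f\<^sup>(\<^sup>k\<^sup>)(a)\<close>.\<close>

lemma parts_sum_taylor_monom:
  assumes "k < n"
  shows "parts_sum n f (smult ((- 1) ^ (n - 1 - k)) (taylor_monom a (n - 1 - k))) a = nth_deriv k f a"
proof -
  let ?m = "n - 1 - k"
  have "parts_sum n f (smult ((- 1) ^ ?m) (taylor_monom a ?m)) a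
      = (\<Sum>j<n. if j = ?m then nth_deriv (n - Suc j) f a else 0)"
    unfolding parts_sum_def
    by (intro sum.cong) (auto simp: higher_pderiv_smult higher_pderiv_taylor_monom_at_centre)
  also have "\<dots> = nth_deriv k f a" using assms by simp
  finally show ?thesis .
qed

section \<open>The representer of a point evaluation\<close>

text \<open>On all of \<open>[0,1]\<close> the polynomial \<open>q\<close> contributes nothing, because the boundary terms vanish at
  both ends; on \<open>[0,a]\<close> the truncated power contributes the boundary term at \<open>a\<close>.\<close>

lemma representer_of_spline:
  assumes f: "f \<in> sobolev0 n" and k: "k < n" and a: "a \<in> {0<..<1}" and q: "degree q < n"
    and g: "g \<in> sobolev0 n"
    and gn: "\<And>x. x \<in> {0..1} - {a} \<Longrightarrow> nth_deriv n g x
      = spline (q + smult ((- 1) ^ (n - 1 - k)) (taylor_monom a (n - 1 - k))) q a x"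
  shows "nth_deriv k f a = (\<integral>x. nth_deriv n f x * nth_deriv n g x \<partial>lebesgue_on {0..1})"
proof -
  let ?t = "smult ((- 1) ^ (n - 1 - k)) (taylor_monom a (n - 1 - k))"
  have n: "n \<ge> 1" using k by simp
  have t: "degree ?t < n"
    using k degree_smult_le[of "(- 1) ^ (n - 1 - k)" "taylor_monom a (n - 1 - k)"]
    by (simp add: degree_taylor_monom)
  have h1: "((\<lambda>x. nth_deriv n f x * poly q x) has_integral 0) {0..1}"
    using sobolev0_integration_by_parts[OF f n q, of 0 1] by (simp add: parts_sum_endpoints[OF f])
  have "((\<lambda>x. nth_deriv n f x * poly ?t x) has_integral nth_deriv k f a) {0..a}"
    using sobolev0_integration_by_parts[OF f n t, of 0 a] a parts_sum_taylor_monom[OF k, of f a]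
    by (simp add: parts_sum_endpoints[OF f] del: poly_smult)
  then have h2: "((\<lambda>x. if x \<in> {0..a} then nth_deriv n f x * poly ?t x else 0) has_integral nth_deriv k f a) {0..1}"
    using a by (subst has_integral_restrict) auto
  have "((\<lambda>x. nth_deriv n f x * poly q x +
      (if x \<in> {0..a} then nth_deriv n f x * poly ?t x else 0)) has_integral nth_deriv k f a) {0..1}"
    using has_integral_add[OF h1 h2] unfolding add_0_left .
  then have "((\<lambda>x. nth_deriv n f x * nth_deriv n g x) has_integral nth_deriv k f a) {0..1}"
    by (rule has_integral_spike_finite[of "{a}", rotated 2])
      (use gn in \<open>auto simp: spline_def algebra_simps\<close>)
  moreover have "((\<lambda>x. nth_deriv n f x * nth_deriv n g x) has_integral
      (\<integral>x. nth_deriv n f x * nth_deriv n g x \<partial>lebesgue_on {0..1})) {0..1}"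
    using sobolev0_mult_integrable[OF f g] by (rule has_integral_integral_lebesgue_on) simp
  ultimately show ?thesis by (rule has_integral_unique)
qed

text \<open>Testing both representers against \<open>g\<close> and \<open>h\<close> gives \<open>g\<^sup>(\<^sup>n\<^sup>) = h\<^sup>(\<^sup>n\<^sup>)\<close> almost everywhere. Integrating from \<open>0\<close>,
  where the derivatives of order \<open>n - 1\<close> vanish, makes those agree everywhere.\<close>

lemma riesz_representer_unique:
  assumes n: "n \<ge> 1" and g: "riesz_representer n k a g" and h: "riesz_representer n k a h"
    and x: "x \<in> {0..1}"
  shows "nth_deriv (n - 1) g x = nth_deriv (n - 1) h x"
proof -
  let ?M = "lebesgue_on {0..1::real}"
  let ?u = "nth_deriv n g" and ?v = "nth_deriv n h"
  have gS: "g \<in> sobolev0 n" and hS: "h \<in> sobolev0 n"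
    using g h by (auto simp: riesz_representer_def)
  \<comment> \<open>The value at \<open>a\<close> of the \<open>k\<close>-th derivative of \<open>g\<close> (first line) and of \<open>h\<close> (second line),
    computed with either representer.\<close>
  have I: "(\<integral>x. ?u x * ?u x \<partial>?M) = (\<integral>x. ?u x * ?v x \<partial>?M)"
          "(\<integral>x. ?v x * ?u x \<partial>?M) = (\<integral>x. ?v x * ?v x \<partial>?M)"
    using g h gS hS unfolding riesz_representer_def by metis+
  note int = sobolev0_mult_integrable[OF gS gS] sobolev0_mult_integrable[OF gS hS]
    sobolev0_mult_integrable[OF hS gS] sobolev0_mult_integrable[OF hS hS]
  have eq: "(?u x - ?v x)\<^sup>2 = (?u x * ?u x - ?u x * ?v x) - (?v x * ?u x - ?v x * ?v x)" for x
    by (simp add: power2_eq_square algebra_simps)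
  have "(\<integral>x. (?u x - ?v x)\<^sup>2 \<partial>?M) = 0"
    unfolding eq using I
    by (simp only: Bochner_Integration.integral_diff Bochner_Integration.integrable_diff int)
  moreover have "integrable ?M (\<lambda>x. (?u x - ?v x)\<^sup>2)"
    unfolding eq using int by simp
  ultimately have "AE x in ?M. (?u x - ?v x)\<^sup>2 = 0"
    by (subst (asm) integral_nonneg_eq_0_iff_AE) auto
  then have "AE x in lebesgue. x \<in> {0..1} \<longrightarrow> ?u x = ?v x"
    by (subst (asm) AE_restrict_space_iff) auto
  then obtain N where N: "N \<in> null_sets lebesgue" "{x. \<not> (x \<in> {0..1} \<longrightarrow> ?u x = ?v x)} \<subseteq> N"
    by (auto simp: eventually_ae_filter)
  have ftc: "(nth_deriv n f has_integral nth_deriv (n - 1) f x) {0..x}" if f: "f \<in> sobolev0 n" for f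
  proof -
    obtain N where N: "negligible N"
      "\<And>j x. j < n \<Longrightarrow> x \<in> {0..1} - N \<Longrightarrow>
        (nth_deriv j f has_vector_derivative nth_deriv (Suc j) f x) (at x within {0..1})"
      using sobolev0_has_vector_derivative[OF f n] by blast
    have "(nth_deriv n f has_integral nth_deriv (n - 1) f x - nth_deriv (n - 1) f 0) {0..x}"
    proof (rule fundamental_theorem_of_calculus_absolutely_continuous[OF _ _ N(1)])
      show "absolutely_continuous_fun_on {0..x} (nth_deriv (n - 1) f)"
        by (rule absolutely_continuous_fun_on_subset[of "{0..1}"]) (use f n x in \<open>auto simp: sobolev0_def\<close>)
      fix t assume "t \<in> {0..x} - N"
      then show "(nth_deriv (n - 1) f has_vector_derivative nth_deriv n f t) (at t within {0..x})"
        using has_vector_derivative_within_subset[OF N(2)[of "n - 1" t], of "{0..x}"] x n by auto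
    qed (use x in auto)
    then show ?thesis using f n by (simp add: sobolev0_def)
  qed
  have "(?v has_integral nth_deriv (n - 1) g x) {0..x}"
    by (rule has_integral_spike[OF _ _ ftc[OF gS], of N])
      (use N x in \<open>auto simp: negligible_iff_null_sets\<close>)
  then show ?thesis using ftc[OF hS] by (rule has_integral_unique)
qed

text \<open>The function is \<open>T + P\<close> to the left of \<open>a\<close> and \<open>P\<close> to the right. Here \<open>T\<close> is an \<open>n\<close>-fold
  antiderivative of \<open>(a - x)\<^sup>n\<^sup>-\<^sup>1\<^sup>-\<^sup>k / (n-1-k)!\<close> that vanishes at \<open>a\<close> to order \<open>2n-1-k \<ge> n\<close>, so the two pieces
  match there up to order \<open>n - 1\<close>; \<open>P\<close> gives the zero boundary data at \<open>0\<close> and \<open>1\<close>. As \<open>degree P < 2n\<close>,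
  its \<open>n\<close>-th derivative has degree less than \<open>n\<close>.\<close>

lemma spline_representer_exists:
  assumes k: "k < n" and a: "a \<in> {0<..<1}"
  obtains q g where "degree q < n" "riesz_representer n k a g"
    "\<And>x. x \<in> {0..1} - {a} \<Longrightarrow> nth_deriv (n - 1) g differentiable (at x within {0..1})"
    "\<And>x. x \<in> {0..1} - {a} \<Longrightarrow> nth_deriv n g x
       = spline (q + smult ((- 1) ^ (n - 1 - k)) (taylor_monom a (n - 1 - k))) q a x"
proof -
  let ?m = "n - 1 - k"
  define T where "T = smult ((- 1) ^ ?m) (taylor_monom a (?m + n))"
  have n: "n \<ge> 1" using k by simp
  obtain P where P: "degree P < 2 * n" "[:0, 1:] ^ n dvd T + P" "[:- 1, 1:] ^ n dvd P"
    by (rule hermite_two_point[of n T]) (use n in simp)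
  have Tn: "(pderiv ^^ n) T = smult ((- 1) ^ ?m) (taylor_monom a ?m)"
    unfolding T_def higher_pderiv_smult higher_pderiv_taylor_monom ..
  have agree: "poly ((pderiv ^^ j) (T + P)) a = poly ((pderiv ^^ j) P) a" if "j < n" for j
    unfolding T_def higher_pderiv_add higher_pderiv_smult poly_add poly_smult
      higher_pderiv_taylor_monom_at_centre
    using that k by simp
  define g where "g = spline (T + P) P a"
  define q where "q = (pderiv ^^ n) P"
  have gS: "g \<in> sobolev0 n"
    unfolding g_def using agree a n
  proof (rule spline_in_sobolev0)
    fix j assume "j < n"
    then show "poly ((pderiv ^^ j) (T + P)) 0 = 0"
      using P(2) by (intro higher_pderiv_root[of 0 n]) simp_all
    show "poly ((pderiv ^^ j) P) 1 = 0"
      using P(3) \<open>j < n\<close> by (intro higher_pderiv_root[of 1 n])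
  qed
  have *: "Suc (n - 1) = n" using n by simp
  have Dn: "(nth_deriv (n - 1) g has_vector_derivative
        spline (q + smult ((- 1) ^ ?m) (taylor_monom a ?m)) q a x) (at x within {0..1})"
      "nth_deriv n g x = spline (q + smult ((- 1) ^ ?m) (taylor_monom a ?m)) q a x"
    if "x \<in> {0..1} - {a}" for x
  proof -
    have x: "n - 1 < n" "x \<in> {0..1}" "Suc (n - 1) < n \<or> x \<noteq> a" using that n by auto
    note D = nth_deriv_spline_differentiable[of n "T + P" a P "n - 1" x, OF agree x,
        unfolded * g_def[symmetric] higher_pderiv_add Tn q_def[symmetric]
          add.commute[of "smult ((- 1) ^ ?m) (taylor_monom a ?m)"]]
    show "(nth_deriv (n - 1) g has_vector_derivative
        spline (q + smult ((- 1) ^ ?m) (taylor_monom a ?m)) q a x) (at x within {0..1})"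
      by (rule D(1))
    show "nth_deriv n g x = spline (q + smult ((- 1) ^ ?m) (taylor_monom a ?m)) q a x"
      by (rule D(2))
  qed
  have q: "degree q < n" using P(1) n by (simp add: q_def degree_higher_pderiv)
  have "riesz_representer n k a g"
    unfolding riesz_representer_def
    using gS representer_of_spline[OF _ k a q gS Dn(2)] by blast
  then show thesis
    using that[of q g] q Dn differentiableI_vector by blast
qed

theorem mainTheorem2:
  fixes n k :: nat and a :: real and p p' :: ennreal and Qhat g :: "real \<Rightarrow> real"
  assumes n: "n \<ge> 1"
    and k: "k \<in> {0..n - 1}"
    and a: "a \<in> {0<..<1}"
    and p: "1 \<le> p"
    and conj: "1 / p + 1 / p' = 1"
    and Q: "Qhat \<in> Q_family n k a"
    and Q_min: "\<forall>q\<in>Q_family n k a. Lp_norm p' Qhat \<le> Lp_norm p' q"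
    and g: "riesz_representer n k a g"
  shows "\<exists>c :: nat \<Rightarrow> real. \<forall>x\<in>{0..1} - {a}.
           nth_deriv (n - 1) g differentiable (at x within {0..1}) \<and>
           Qhat x - nth_deriv n g x = (\<Sum>l=0..n - 1. c l * x ^ l)"
proof -
  let ?t = "smult ((- 1) ^ (n - 1 - k)) (taylor_monom a (n - 1 - k))"
  have kn: "k < n" using k n by auto
  obtain q h where q: "degree q < n" and h: "riesz_representer n k a h"
    and dh: "\<And>x. x \<in> {0..1} - {a} \<Longrightarrow> nth_deriv (n - 1) h differentiable (at x within {0..1})"
    and hn: "\<And>x. x \<in> {0..1} - {a} \<Longrightarrow> nth_deriv n h x = spline (q + ?t) q a x"
    using spline_representer_exists[OF kn a] by blast
  have gh: "nth_deriv (n - 1) g x = nth_deriv (n - 1) h x" if "x \<in> {0..1}" for x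
    using riesz_representer_unique[OF n g h that] .
  have *: "Suc (n - 1) = n" using n by simp
  have gn: "nth_deriv n g x = spline (q + ?t) q a x" if "x \<in> {0..1} - {a}" for x
    using nth_deriv_Suc_cong[OF gh, of x] hn[OF that] that unfolding * by simp
  have dg: "nth_deriv (n - 1) g differentiable (at x within {0..1})" if x: "x \<in> {0..1} - {a}" for x
  proof -
    have "(nth_deriv (n - 1) h has_vector_derivative nth_deriv n h x) (at x within {0..1})"
      using has_vector_derivative_nth_deriv[OF dh[OF x]] unfolding * .
    then have "(nth_deriv (n - 1) g has_vector_derivative nth_deriv n h x) (at x within {0..1})"
      using has_vector_derivative_transform[of x "{0..1}" "nth_deriv (n - 1) g"] gh x by blast
    then show ?thesis by (rule differentiableI_vector)
  qed
  obtain \<nu> where \<nu>: "is_Q n k a \<nu> Qhat" using Q by (auto simp: Q_family_def)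
  define V where "V = (\<Sum>l=0..n - 1. smult ((- 1) ^ (n - 1 - l) * \<nu> l) (taylor_monom a (n - 1 - l)))"
  have V: "poly V x = (\<Sum>l=0..n - 1. (-1) ^ (n - l - 1) * (x - a) ^ (n - 1 - l) * \<nu> l / fact (n - 1 - l))"
    for x
    unfolding V_def poly_sum
    by (intro sum.cong) (simp_all add: poly_taylor_monom diff_commute mult.assoc mult.left_commute mult.commute)
  have degV: "degree V \<le> n - 1"
    unfolding V_def
    by (intro degree_sum_le) (auto intro: order_trans[OF degree_smult_le] simp: degree_taylor_monom)
  have Qx: "Qhat x = spline (V + ?t) V a x" if x: "x \<in> {0..1} - {a}" for x
  proof (cases "x < a")
    case True
    have "poly V x = (\<Sum>l\<in>{0..n - 1} - {k}. (-1) ^ (n - l - 1) * (x - a) ^ (n - 1 - l) * \<nu> l / fact (n - 1 - l))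
        + (-1) ^ (n - k - 1) * (x - a) ^ (n - 1 - k) * \<nu> k / fact (n - 1 - k)"
      unfolding V using k by (subst sum.remove[of _ k]) auto
    then show ?thesis
      using \<nu> x True unfolding is_Q_def
      by (simp add: spline_def poly_taylor_monom diff_commute field_simps)
  next
    case False
    then show ?thesis using \<nu> x by (simp add: is_Q_def V spline_def)
  qed
  have "degree (V - q) \<le> n - 1" using degV q by (intro degree_diff_le) auto
  then have "poly (V - q) x = poly (\<Sum>l\<le>n - 1. monom (coeff (V - q) l) l) x" for x
    by (simp only: poly_as_sum_of_monoms')
  then have "poly (V - q) x = (\<Sum>l=0..n - 1. coeff (V - q) l * x ^ l)" for x
    by (simp only: poly_sum poly_monom atMost_atLeast0)
  then have "Qhat x - nth_deriv n g x = (\<Sum>l=0..n - 1. coeff (V - q) l * x ^ l)" if "x \<in> {0..1} - {a}" for x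
    using gn[OF that] Qx[OF that] by (simp add: spline_def)
  then show ?thesis using dg by blast
qed

end
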